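(* Any universal geometric cluster algebra is prime gluing free.
   Context: Ice quivers. An ice quiver is a finite quiver $Q$ (no loops, no 2-cycles) with vertex set $\{1,\dots,n+m\}$ and a subset $\{n+1,\dots,n+m\}$ of frozen vertices ($m=0$ allowed); the vertices $1,\dots,n$ are exchangeable; there are no arrows between frozen vertices. The principal part is the full subquiver on the exchangeable vertices. Standing assumption: an ice quiver and its principal part are connected. The exchange matrix is $B=(b_{ji})$, of size $(n+m)\times n$, with $b_{ji}=\#\{\text{arrows } j\to i\}-\#\{\text{arrows } i\to j\}$. Mutation and cluster algebras. The mutation $\mu_i(Q)$ at an exchangeable vertex $i$: add an arrow $j\to k$ for each path $j\to i\to k$; reverse all arrows incident to $i$; remove a maximal set of pairwise disjoint 2-cycles; remove arrows between frozen vertices. A seed is $(Q,\mathbf{x})$ with $\mathbf{x}=\{x_1,\dots,x_{n+m}\}$ (the cluster), initially independent indeterminates, $x_i$ attached to vertex $i$. Mutation at exchangeable $i$ replaces $Q$ by $\mu_i(Q)$ and $x_i$ by $x_i'$, where $x_ix_i'=\prod_{1\le j\le n+m,\,b_{ji}>0}x_j^{b_{ji}}+\prod_{1\le j\le n+m,\,b_{ji}<0}x_j^{-b_{ji}}$. The seeds of $\mathcal{A}_Q$ are all seeds obtained from the initial one by iterated mutation; $\mathcal{A}_Q$ is the $\mathbb{Z}$-subalgebra of $\mathbb{Q}(x_1,\dots,x_{n+m})$ generated by all elements of all clusters. A rooted cluster algebra of $\mathcal{A}$ is a triple $(Q,\mathbf{x},\mathcal{A})$ with $(Q,\mathbf{x})$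 a seed of $\mathcal{A}$ (its initial seed). The coefficient group $\mathbb{P}$ of $\mathcal{A}_Q$ is the multiplicative free abelian group generated by the frozen variables, and $\mathcal{A}_Q[\mathbb{P}^{-1}]$ is the localization of $\mathcal{A}_Q$ at $\mathbb{P}$. Universality. For a quiver $Q$ with $n$ vertices and no frozen vertices, $RCA(Q)$ is the set of rooted cluster algebras $(\tilde Q,\tilde{\mathbf{x}},\mathcal{A}_{\tilde Q})$ with $\tilde Q$ an ice quiver with principal part $Q$. Admissible sequences $\varpi$ are identified with finite (possibly empty) sequences of exchangeable vertices $1,\dots,n$, and $\mu_\varpi(x_i)$ is the variable at vertex $i$ after mutating the initial seed along $\varpi$. For $(Q',\mathbf{x}',\mathcal{A}_{Q'})$, $(Q'',\mathbf{x}'',\mathcal{A}_{Q''})$ in $RCA(Q)$ with coefficient groups $\mathbb{P}',\mathbb{P}''$, a coefficient specialization is a group homomorphism $\varphi:\mathbb{P}'\to\mathbb{P}''$ that extends to a ring homomorphism $\varphi:\mathcal{A}_{Q'}[\mathbb{P}'^{-1}]\to\mathcal{A}_{Q''}[\mathbb{P}''^{-1}]$ such that $\varphi(\mu_\varpi(x_i'))=\mu_\varpi(x_i'')$ for all $1\le i\le n$ and all admissible $\varpi$; the extension is also called a coefficient specialization. For $(Q^{univ},\mathbf{x}^{univ},\mathcal{A}_{Q^{univ}})$ in $RCA(Q)$ with coefficient group $\mathbb{P}$, $\mathcal{A}_{Q^{univ}}$ is a universal geometric cluster algebra of $RCA(Q)$ if for every $(Q',\mathbf{x}',\mathcal{A}_{Q'})$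 in $RCA(Q)$ with coefficient group $\mathbb{P}'$ there is a unique coefficient specialization from $\mathcal{A}_{Q^{univ}}[\mathbb{P}^{-1}]$ to $\mathcal{A}_{Q'}[\mathbb{P}'^{-1}]$. Gluing. In an ice quiver with exchange matrix $(b_{ji})$, two frozen vertices $j,k$ are glueable if there is a positive rational number $n_{jk}$ with $b_{ji}=n_{jk}b_{ki}$ for every exchangeable vertex $i$. A frozen vertex $j$ is prime if $\gcd(b_{j1},\dots,b_{jn})=1$. The ice quiver is prime gluing free if all its frozen vertices are prime and no two distinct frozen vertices are glueable. A cluster algebra $\mathcal{A}$ is prime gluing free if there is a rooted cluster algebra $(Q,\mathbf{x},\mathcal{A})$ of $\mathcal{A}$ with $Q$ prime gluing free. *)

theory Defs
  imports
    "HOL-Library.FuncSet"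
    "HOL-Library.Poly_Mapping"
    "HOL-Computational_Algebra.Fraction_Field"
    "HOL-Algebra.Algebraic_Closure_Type"
    "HOL-Algebra.Generated_Rings"
    "HOL-Algebra.Elementary_Groups"
begin

section \<open>Ice quivers\<close>

text \<open>
  A finite quiver is recorded by the number \<open>arrows Q j k\<close> of arrows from \<open>j\<close> to \<open>k\<close>.
  The exchangeable vertices are \<open>1, \<dots>, n\<close> and the frozen ones \<open>n + 1, \<dots>, n + m\<close>,
  where \<open>n = num_exch Q\<close> and \<open>m = num_frozen Q\<close>.
\<close>

record quiver =
  num_exch :: nat
  num_frozen :: nat
  arrows :: "nat \<Rightarrow> nat \<Rightarrow> nat"

definition exch :: "quiver \<Rightarrow> nat set" where
  "exch Q = {1..num_exch Q}"

definition frozen :: "quiver \<Rightarrow> nat set" where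
  "frozen Q = {num_exch Q + 1..num_exch Q + num_frozen Q}"

definition verts :: "quiver \<Rightarrow> nat set" where
  "verts Q = {1..num_exch Q + num_frozen Q}"

text \<open>As usual, connected includes nonempty; so an ice quiver has \<open>n \<ge> 1\<close>.\<close>

definition connected_quiver :: "quiver \<Rightarrow> bool" where
  "connected_quiver Q \<longleftrightarrow> verts Q \<noteq> {} \<and>
     (\<forall>j \<in> verts Q. \<forall>k \<in> verts Q.
        (j, k) \<in> {(a, b). a \<in> verts Q \<and> b \<in> verts Q \<and> (arrows Q a b > 0 \<or> arrows Q b a > 0)}\<^sup>*)"

definition principal_part :: "quiver \<Rightarrow> quiver" where
  "principal_part Q = \<lparr>num_exch = num_exch Q, num_frozen = 0,
     arrows = (\<lambda>j k. if j \<in> exch Q \<and> k \<in> exch Q then arrows Q j k else 0)\<rparr>"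

text \<open>
  The first clause only normalises the junk values of \<open>arrows\<close>, so that equality
  of records is equality of quivers.
\<close>

definition ice_quiver :: "quiver \<Rightarrow> bool" where
  "ice_quiver Q \<longleftrightarrow>
     (\<forall>j k. j \<notin> verts Q \<or> k \<notin> verts Q \<longrightarrow> arrows Q j k = 0) \<and>
     (\<forall>j. arrows Q j j = 0) \<and>
     (\<forall>j k. arrows Q j k = 0 \<or> arrows Q k j = 0) \<and>
     (\<forall>j \<in> frozen Q. \<forall>k \<in> frozen Q. arrows Q j k = 0) \<and>
     connected_quiver Q \<and> connected_quiver (principal_part Q)"

definition exchange_matrix :: "quiver \<Rightarrow> nat \<Rightarrow> nat \<Rightarrow> int" where
  "exchange_matrix Q j i = int (arrows Q j i) - int (arrows Q i j)"

text \<open>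
  The three \<open>let\<close> steps are: add an arrow for every path through \<open>i\<close>; reverse the arrows at \<open>i\<close>;
  cancel 2-cycles (the subtraction is truncated). Finally arrows between frozen vertices are dropped.
\<close>

definition mutate_quiver :: "nat \<Rightarrow> quiver \<Rightarrow> quiver" where
  "mutate_quiver i Q =
     (let a = (\<lambda>j k. arrows Q j k + arrows Q j i * arrows Q i k);
          r = (\<lambda>j k. if j = i \<or> k = i then a k j else a j k);
          c = (\<lambda>j k. r j k - r k j)
      in Q\<lparr>arrows := (\<lambda>j k. if j \<in> frozen Q \<and> k \<in> frozen Q then 0 else c j k)\<rparr>)"


section \<open>Seeds and cluster algebras\<close>

text \<open>
  The ambient field is \<open>\<rat>(x\<^sub>0, x\<^sub>1, x\<^sub>2, \<dots>)\<close>. A cluster algebra on \<open>n + m\<close> vertices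
  lies in its subfield \<open>\<rat>(x\<^sub>1, \<dots>, x\<^sub>n\<^sub>+\<^sub>m)\<close>.
\<close>

type_synonym ratfun = "((nat \<Rightarrow>\<^sub>0 nat) \<Rightarrow>\<^sub>0 rat) fract"

definition indet :: "nat \<Rightarrow> ratfun" where
  "indet v = Fract (Poly_Mapping.single (Poly_Mapping.single v 1) 1) 1"

text \<open>A cluster is a family indexed by vertices; its values outside \<open>verts Q\<close> are irrelevant.\<close>

type_synonym seed = "quiver \<times> (nat \<Rightarrow> ratfun)"

definition initial_seed :: "quiver \<Rightarrow> seed" where
  "initial_seed Q = (Q, indet)"

definition exchanged_var :: "seed \<Rightarrow> nat \<Rightarrow> ratfun" where
  "exchanged_var S i = (case S of (Q, x) \<Rightarrow>
     ((\<Prod>j | j \<in> verts Q \<and> exchange_matrix Q j i > 0. x j ^ nat (exchange_matrix Q j i)) +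
      (\<Prod>j | j \<in> verts Q \<and> exchange_matrix Q j i < 0. x j ^ nat (- exchange_matrix Q j i))) / x i)"

definition mutate_seed :: "nat \<Rightarrow> seed \<Rightarrow> seed" where
  "mutate_seed i S = (mutate_quiver i (fst S), (snd S)(i := exchanged_var S i))"

text \<open>Mutation along a sequence, first entry first.\<close>

definition mutate_along :: "nat list \<Rightarrow> seed \<Rightarrow> seed" where
  "mutate_along w S = fold mutate_seed w S"

definition admissible :: "quiver \<Rightarrow> nat list \<Rightarrow> bool" where
  "admissible Q w \<longleftrightarrow> set w \<subseteq> exch Q"

text \<open>A cluster algebra is an algebra together with its set of seeds.\<close>

record cluster_alg =
  seeds :: "seed set"
  elements :: "ratfun set"

definition seeds_of :: "quiver \<Rightarrow> seed set" where
  "seeds_of Q = {mutate_along w (initial_seed Q) | w. admissible Q w}"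

abbreviation ambient :: "ratfun ring" where
  "ambient \<equiv> ring_of_type_algebra"

definition cluster_algebra :: "quiver \<Rightarrow> cluster_alg" where
  "cluster_algebra Q = \<lparr>seeds = seeds_of Q,
     elements = generate_ring ambient {x j | Q' x j. (Q', x) \<in> seeds_of Q \<and> j \<in> verts Q'}\<rparr>"

definition frozen_variables :: "cluster_alg \<Rightarrow> ratfun set" where
  "frozen_variables A = {x j | Q x j. (Q, x) \<in> seeds A \<and> j \<in> frozen Q}"

text \<open>
  Frozen variables are algebraically independent, so the subgroup they generate in the
  multiplicative group of the ambient field is free abelian on them.
\<close>

definition coefficient_group :: "cluster_alg \<Rightarrow> ratfun monoid" where
  "coefficient_group A = subgroup_generated (mult_of ambient) (frozen_variables A)"

text \<open>
  Frozen variables lie in the algebra, so it is enough to use fractions with numerator in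
  the algebra and denominator in the coefficient group.
\<close>

definition localized_algebra :: "cluster_alg \<Rightarrow> ratfun ring" where
  "localized_algebra A =
     ambient\<lparr>carrier := {a / p | a p. a \<in> elements A \<and> p \<in> carrier (coefficient_group A)}\<rparr>"


section \<open>Rooted cluster algebras and universality\<close>

type_synonym rooted = "quiver \<times> (nat \<Rightarrow> ratfun) \<times> cluster_alg"

definition rooted_cluster_algebra :: "rooted \<Rightarrow> bool" where
  "rooted_cluster_algebra R \<longleftrightarrow> (case R of (Q, x, A) \<Rightarrow> (Q, x) \<in> seeds A)"

definition RCA :: "quiver \<Rightarrow> rooted set" where
  "RCA Q = {(Q', x', A). ice_quiver Q' \<and> principal_part Q' = Q \<and>
     A = cluster_algebra Q' \<and> rooted_cluster_algebra (Q', x', A)}"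

text \<open>
  The map below is the extension to the localized algebras. Being in \<open>hom\<close> says that it
  restricts to a homomorphism of coefficient groups.
\<close>

definition coefficient_specialization :: "rooted \<Rightarrow> rooted \<Rightarrow> (ratfun \<Rightarrow> ratfun) \<Rightarrow> bool" where
  "coefficient_specialization R' R'' \<phi> \<longleftrightarrow>
     (case (R', R'') of ((Q', x', A'), (Q'', x'', A'')) \<Rightarrow>
        \<phi> \<in> hom (coefficient_group A') (coefficient_group A'') \<and>
        \<phi> \<in> ring_hom (localized_algebra A') (localized_algebra A'') \<and>
        (\<forall>w. admissible Q' w \<longrightarrow> (\<forall>i \<in> exch Q'.
           \<phi> (snd (mutate_along w (Q', x')) i) = snd (mutate_along w (Q'', x'')) i)))"

text \<open>
  Maps are total functions in HOL; \<open>extensional\<close> fixes their values outside the domain, so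
  that uniqueness means uniqueness on the localized algebra.
\<close>

definition universal_geometric :: "quiver \<Rightarrow> cluster_alg \<Rightarrow> bool" where
  "universal_geometric Q A \<longleftrightarrow>
     (\<exists>Qu xu. (Qu, xu, A) \<in> RCA Q \<and>
        (\<forall>R' \<in> RCA Q. \<exists>!\<phi>. \<phi> \<in> extensional (carrier (localized_algebra A)) \<and>
           coefficient_specialization (Qu, xu, A) R' \<phi>))"


section \<open>Gluing\<close>

definition glueable :: "quiver \<Rightarrow> nat \<Rightarrow> nat \<Rightarrow> bool" where
  "glueable Q j k \<longleftrightarrow> j \<in> frozen Q \<and> k \<in> frozen Q \<and>
     (\<exists>r::rat. r > 0 \<and>
        (\<forall>i \<in> exch Q. of_int (exchange_matrix Q j i) = r * of_int (exchange_matrix Q k i)))"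

definition prime_vertex :: "quiver \<Rightarrow> nat \<Rightarrow> bool" where
  "prime_vertex Q j \<longleftrightarrow> j \<in> frozen Q \<and> Gcd (exchange_matrix Q j ` exch Q) = 1"

definition prime_gluing_free_quiver :: "quiver \<Rightarrow> bool" where
  "prime_gluing_free_quiver Q \<longleftrightarrow>
     (\<forall>j \<in> frozen Q. prime_vertex Q j) \<and>
     (\<forall>j \<in> frozen Q. \<forall>k \<in> frozen Q. j \<noteq> k \<longrightarrow> \<not> glueable Q j k)"

definition prime_gluing_free :: "cluster_alg \<Rightarrow> bool" where
  "prime_gluing_free A \<longleftrightarrow>
     (\<exists>Q x. rooted_cluster_algebra (Q, x, A) \<and> prime_gluing_free_quiver Q)"

end

theory Submission
  imports Defs "HOL-Combinatorics.Permutations"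
begin

text \<open>
  Mutation scales linearly in the arrows at a frozen vertex. Hence, if one ice quiver arises from
  another by multiplying the arrows at each frozen vertex \<open>v\<close> by \<open>d v\<close> and permuting frozen vertices
  by \<open>\<pi>\<close>, the field endomorphism sending \<open>x\<^sub>v\<close> to the power \<open>d v\<close> of the variable at \<open>\<pi> v\<close>
  is a coefficient specialization.

  Let \<open>Qu\<close> be universal. If the row of a frozen vertex \<open>j\<close> had greatest common divisor \<open>p > 1\<close>,
  dividing it by \<open>p\<close> would give a quiver \<open>Q'\<close> and a specialization \<open>Q' \<rightarrow> Qu\<close> raising the variable
  at \<open>j\<close> to its \<open>p\<close>-th power. Composed with the universal specialization \<open>Qu \<rightarrow> Q'\<close> it is the
  identity by uniqueness, although the variable at \<open>j\<close> is not in its image on coefficient groups.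
  So all frozen vertices are prime, glueable ones have equal rows, and swapping two of them
  would be a second specialization \<open>Qu \<rightarrow> Qu\<close> besides the identity.
\<close>

section \<open>Monomial substitutions in the ambient field\<close>

locale field_hom =
  fixes f :: "'a::field \<Rightarrow> 'b::field"
  assumes hom_add: "f (x + y) = f x + f y"
    and hom_mult: "f (x * y) = f x * f y"
    and hom_one: "f 1 = 1"
begin

lemma hom_zero: "f 0 = 0"
  by (metis add_cancel_right_right add_0 hom_add)

lemma hom_uminus: "f (- x) = - f x"
  using hom_add[of x "- x"] by (simp add: hom_zero eq_neg_iff_add_eq_0 add.commute)

lemma hom_inverse: "f (inverse x) = inverse (f x)"
proof (cases "x = 0")
  case False
  then show ?thesis
    using hom_mult[of x "inverse x"] hom_one by (metis inverse_unique right_inverse)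
qed (simp add: hom_zero)

lemma hom_divide: "f (x / y) = f x / f y"
  by (simp add: divide_inverse hom_mult hom_inverse)

lemma hom_power: "f (x ^ n) = f x ^ n"
  by (induction n) (simp_all add: hom_one hom_mult)

lemma hom_prod: "f (\<Prod>i\<in>I. g i) = (\<Prod>i\<in>I. f (g i))"
  by (induction I rule: infinite_finite_induct) (simp_all add: hom_one hom_mult)

end

definition fract_map :: "('a::idom \<Rightarrow> 'b::idom) \<Rightarrow> 'a fract \<Rightarrow> 'b fract" where
  "fract_map h x = (SOME y. \<exists>a b. b \<noteq> 0 \<and> x = Fract a b \<and> y = Fract (h a) (h b))"

text \<open>\<open>fract_map\<close> chooses its value among all ways of writing the argument as a
  fraction. The choice is irrelevant here: equal fractions satisfy a cross-multiplication identity,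
  which \<open>h\<close> preserves, and the images of denominators stay nonzero.\<close>

lemma fract_map_Fract:
  fixes h :: "'a::idom \<Rightarrow> 'b::idom"
  assumes mult: "\<And>x y. h (x * y) = h x * h y" and nonzero: "\<And>x. x \<noteq> 0 \<Longrightarrow> h x \<noteq> 0"
    and "b \<noteq> 0"
  shows "fract_map h (Fract a b) = Fract (h a) (h b)"
  unfolding fract_map_def
proof (rule some_equality)
  fix y assume "\<exists>c d. d \<noteq> 0 \<and> Fract a b = Fract c d \<and> y = Fract (h c) (h d)"
  then obtain c d where cd: "d \<noteq> 0" "Fract a b = Fract c d" "y = Fract (h c) (h d)" by blast
  then have "a * d = c * b"
    using \<open>b \<noteq> 0\<close> by (simp add: eq_fract)
  then have "h a * h d = h c * h b"
    by (metis mult)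
  then show "y = Fract (h a) (h b)"
    using cd \<open>b \<noteq> 0\<close> by (simp add: eq_fract nonzero)
qed (use assms in blast)

lemma field_hom_fract_map:
  fixes h :: "'a::idom \<Rightarrow> 'b::idom"
  assumes add: "\<And>x y. h (x + y) = h x + h y"
    and mult: "\<And>x y. h (x * y) = h x * h y" and one: "h 1 = 1"
    and nonzero: "\<And>x. x \<noteq> 0 \<Longrightarrow> h x \<noteq> 0"
  shows "field_hom (fract_map h)"
proof
  note [simp] = fract_map_Fract[of h, OF mult nonzero]
  fix x y :: "'a fract"
  obtain a b where x: "x = Fract a b" "b \<noteq> 0" by (cases x) auto
  obtain c d where y: "y = Fract c d" "d \<noteq> 0" by (cases y) auto
  show "fract_map h (x + y) = fract_map h x + fract_map h y"
    using x y by (simp add: add mult nonzero)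
  show "fract_map h (x * y) = fract_map h x * fract_map h y"
    using x y by (simp add: mult nonzero)
  show "fract_map h 1 = 1"
    by (simp add: One_fract_def one)
qed

section \<open>Homomorphisms of monoid algebras induced by maps of exponents\<close>

definition push_keys :: "('a \<Rightarrow> 'b) \<Rightarrow> ('a \<Rightarrow>\<^sub>0 'c::comm_monoid_add) \<Rightarrow> 'b \<Rightarrow>\<^sub>0 'c" where
  "push_keys s p = (\<Sum>m\<in>Poly_Mapping.keys p. Poly_Mapping.single (s m) (Poly_Mapping.lookup p m))"

text \<open>Keys outside the support contribute zero. Two summands and their sum can thus be
  expanded over one common index set, even when terms cancel.\<close>

lemma push_keys_superset:
  assumes "finite S" "Poly_Mapping.keys p \<subseteq> S"
  shows "push_keys s p = (\<Sum>m\<in>S. Poly_Mapping.single (s m) (Poly_Mapping.lookup p m))"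
  unfolding push_keys_def
  by (rule sum.mono_neutral_left) (use assms in \<open>auto simp: in_keys_iff\<close>)

lemma push_keys_add: "push_keys s (p + q) = push_keys s p + push_keys s q"
proof -
  let ?S = "Poly_Mapping.keys p \<union> Poly_Mapping.keys q"
  show ?thesis
    using Poly_Mapping.keys_add[of p q]
    by (simp add: push_keys_superset[of ?S] lookup_add single_add sum.distrib)
qed

lemma push_keys_single: "push_keys s (Poly_Mapping.single m c) = Poly_Mapping.single (s m) c"
  by (simp add: push_keys_def)

lemma push_keys_sum: "push_keys s (\<Sum>i\<in>I. p i) = (\<Sum>i\<in>I. push_keys s (p i))"
  by (induction I rule: infinite_finite_induct)
    (simp_all add: push_keys_add, simp_all add: push_keys_def)

lemma poly_mapping_sum_single:
  "p = (\<Sum>m\<in>Poly_Mapping.keys p. Poly_Mapping.single m (Poly_Mapping.lookup p m))"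
  by (rule poly_mapping_eqI) (simp add: lookup_sum lookup_single when_def in_keys_iff)

text \<open>Both sides are biadditive, so expansion reduces the claim to two single terms, where it
  is the additivity of \<open>s\<close>.\<close>

lemma push_keys_mult:
  fixes s :: "'a::monoid_add \<Rightarrow> 'b::monoid_add" and p q :: "'a \<Rightarrow>\<^sub>0 'c::semiring_0"
  assumes s: "\<And>m n. s (m + n) = s m + s n"
  shows "push_keys s (p * q) = push_keys s p * push_keys s q"
proof -
  have "push_keys s (p * q) = push_keys s
    ((\<Sum>m\<in>Poly_Mapping.keys p. Poly_Mapping.single m (Poly_Mapping.lookup p m)) *
     (\<Sum>m\<in>Poly_Mapping.keys q. Poly_Mapping.single m (Poly_Mapping.lookup q m)))"
    by (simp flip: poly_mapping_sum_single)
  also have "\<dots> = push_keys s p * push_keys s q"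
    by (simp add: sum_product mult_single push_keys_sum push_keys_single s)
      (simp add: push_keys_def sum_product mult_single)
  finally show ?thesis .
qed

text \<open>Injectivity keeps the coefficients of distinct keys apart, so nothing cancels and a
  nonzero polynomial has a nonzero image.\<close>

lemma lookup_push_keys:
  assumes "inj s"
  shows "Poly_Mapping.lookup (push_keys s p) (s m) = Poly_Mapping.lookup p m"
  using assms
  by (simp add: push_keys_def lookup_sum lookup_single when_def in_keys_iff inj_eq)

lemma push_keys_nonzero:
  assumes "inj s" "p \<noteq> 0"
  shows "push_keys s p \<noteq> 0"
  by (metis assms lookup_push_keys lookup_zero poly_mapping_eqI)

section \<open>Monomials in the ambient field\<close>

definition monomial :: "(nat \<Rightarrow>\<^sub>0 nat) \<Rightarrow> ratfun" where
  "monomial m = Fract (Poly_Mapping.single m 1) 1"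

lemma monomial_0: "monomial 0 = 1"
  by (simp add: monomial_def One_fract_def)

lemma monomial_add: "monomial (m + n) = monomial m * monomial n"
  by (simp add: monomial_def mult_single)

lemma monomial_inject: "monomial m = monomial n \<longleftrightarrow> m = n"
proof
  assume "monomial m = monomial n"
  then have "Poly_Mapping.single m (1::rat) = Poly_Mapping.single n 1"
    by (simp add: monomial_def eq_fract)
  then have "Poly_Mapping.keys (Poly_Mapping.single m (1::rat)) = Poly_Mapping.keys (Poly_Mapping.single n (1::rat))"
    by simp
  then show "m = n" by simp
qed simp

lemma monomial_nonzero: "monomial m \<noteq> 0"
proof -
  have "Poly_Mapping.single m (1::rat) \<noteq> 0"
    by (metis lookup_single_eq lookup_zero zero_neq_one)
  then show ?thesis
    by (simp add: monomial_def Zero_fract_def eq_fract)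
qed

lemma indet_monomial: "indet v = monomial (Poly_Mapping.single v 1)"
  by (simp add: indet_def monomial_def)

lemma indet_power: "indet v ^ k = monomial (Poly_Mapping.single v k)"
proof (induction k)
  case (Suc k)
  then show ?case
    using single_add[of v 1 k] by (simp add: indet_monomial flip: monomial_add)
qed (simp add: monomial_0)

lemma indet_inject: "indet v = indet u \<longleftrightarrow> v = u"
  by (metis indet_monomial inj_single monomial_inject keys_single insert_not_empty
      singleton_insert_inj_eq one_neq_zero)

lemma indet_nonzero: "indet v \<noteq> 0"
  by (simp add: indet_monomial monomial_nonzero)

text \<open>The exponent vector of the image of the monomial with exponents \<open>m\<close> when
  the variable at \<open>v\<close> is replaced by the power \<open>d v\<close> of the variable at
  \<open>\<pi> v\<close>.\<close>

definition relabel_exponent :: "(nat \<Rightarrow> nat) \<Rightarrow> (nat \<Rightarrow> nat) \<Rightarrow> (nat \<Rightarrow>\<^sub>0 nat) \<Rightarrow> (nat \<Rightarrow>\<^sub>0 nat)" where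
  "relabel_exponent \<pi> d m =
     (\<Sum>v\<in>Poly_Mapping.keys m. Poly_Mapping.single (\<pi> v) (d v * Poly_Mapping.lookup m v))"

lemma lookup_relabel_exponent:
  assumes "inj \<pi>"
  shows "Poly_Mapping.lookup (relabel_exponent \<pi> d m) (\<pi> v) = d v * Poly_Mapping.lookup m v"
  using assms
  by (simp add: relabel_exponent_def lookup_sum lookup_single when_def in_keys_iff inj_eq)

lemma relabel_exponent_single:
  "relabel_exponent \<pi> d (Poly_Mapping.single v k) = Poly_Mapping.single (\<pi> v) (d v * k)"
  by (simp add: relabel_exponent_def)

lemma relabel_exponent_add:
  assumes "bij \<pi>"
  shows "relabel_exponent \<pi> d (m + n) = relabel_exponent \<pi> d m + relabel_exponent \<pi> d n"
proof (rule poly_mapping_eqI)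
  fix u
  obtain v where "u = \<pi> v" using assms by (metis bij_pointE)
  with assms show "Poly_Mapping.lookup (relabel_exponent \<pi> d (m + n)) u =
    Poly_Mapping.lookup (relabel_exponent \<pi> d m + relabel_exponent \<pi> d n) u"
    by (simp add: lookup_add lookup_relabel_exponent bij_is_inj algebra_simps)
qed

lemma inj_relabel_exponent:
  assumes "inj \<pi>" "\<And>v. d v > 0"
  shows "inj (relabel_exponent \<pi> d)"
proof (rule injI, rule poly_mapping_eqI)
  fix m n v assume "relabel_exponent \<pi> d m = relabel_exponent \<pi> d n"
  then have "d v * Poly_Mapping.lookup m v = d v * Poly_Mapping.lookup n v"
    by (metis assms(1) lookup_relabel_exponent)
  then show "Poly_Mapping.lookup m v = Poly_Mapping.lookup n v"
    using assms(2)[of v] by simp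
qed

text \<open>The same substitution on the whole field. If \<open>\<pi>\<close> is bijective and
  \<open>d\<close> positive, it is a field endomorphism: the map on exponents is then additive and
  injective, so no nonzero denominator is sent to zero.\<close>

definition relabel :: "(nat \<Rightarrow> nat) \<Rightarrow> (nat \<Rightarrow> nat) \<Rightarrow> ratfun \<Rightarrow> ratfun" where
  "relabel \<pi> d = fract_map (push_keys (relabel_exponent \<pi> d))"

context
  fixes \<pi> d :: "nat \<Rightarrow> nat"
  assumes bij: "bij \<pi>" and pos: "\<And>v. d v > 0"
begin

lemma push_relabel_mult:
  fixes p q :: "(nat \<Rightarrow>\<^sub>0 nat) \<Rightarrow>\<^sub>0 rat"
  shows "push_keys (relabel_exponent \<pi> d) (p * q) =
    push_keys (relabel_exponent \<pi> d) p * push_keys (relabel_exponent \<pi> d) q"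
  by (rule push_keys_mult) (simp add: relabel_exponent_add bij)

lemma push_relabel_nonzero:
  fixes p :: "(nat \<Rightarrow>\<^sub>0 nat) \<Rightarrow>\<^sub>0 rat"
  shows "p \<noteq> 0 \<Longrightarrow> push_keys (relabel_exponent \<pi> d) p \<noteq> 0"
  by (rule push_keys_nonzero) (simp_all add: inj_relabel_exponent bij bij_is_inj pos)

lemma push_relabel_one: "push_keys (relabel_exponent \<pi> d) (1 :: (nat \<Rightarrow>\<^sub>0 nat) \<Rightarrow>\<^sub>0 rat) = 1"
  using push_keys_single[of "relabel_exponent \<pi> d" 0 "1::rat"]
  by (simp add: relabel_exponent_def)

lemma field_hom_relabel: "field_hom (relabel \<pi> d)"
  unfolding relabel_def
  by (rule field_hom_fract_map)
    (simp_all add: push_keys_add push_relabel_mult push_relabel_nonzero push_relabel_one)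

lemma relabel_monomial: "relabel \<pi> d (monomial m) = monomial (relabel_exponent \<pi> d m)"
  unfolding relabel_def monomial_def
  by (subst fract_map_Fract)
    (simp_all add: push_relabel_mult push_relabel_nonzero push_relabel_one push_keys_single)

lemma relabel_indet: "relabel \<pi> d (indet v) = indet (\<pi> v) ^ d v"
  by (simp add: indet_power)
    (simp add: indet_monomial relabel_monomial relabel_exponent_single)

end

section \<open>Mutation commutes with relabelling frozen vertices\<close>

lemma verts_eq: "verts Q = exch Q \<union> frozen Q"
  by (auto simp: verts_def exch_def frozen_def)

lemma exch_frozen_disjoint: "v \<in> exch Q \<Longrightarrow> v \<notin> frozen Q"
  by (auto simp: exch_def frozen_def)

lemma mutate_quiver_simps [simp]:
  "num_exch (mutate_quiver i Q) = num_exch Q"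
  "num_frozen (mutate_quiver i Q) = num_frozen Q"
  "exch (mutate_quiver i Q) = exch Q"
  "frozen (mutate_quiver i Q) = frozen Q"
  by (simp_all add: mutate_quiver_def Let_def exch_def frozen_def)

lemma arrows_mutate_quiver:
  "arrows (mutate_quiver i Q) j k =
    (let a = (\<lambda>j k. arrows Q j k + arrows Q j i * arrows Q i k);
         r = (\<lambda>j k. if j = i \<or> k = i then a k j else a j k)
     in if j \<in> frozen Q \<and> k \<in> frozen Q then 0 else r j k - r k j)"
  by (simp add: mutate_quiver_def Let_def)

lemma fst_mutate_seed [simp]: "fst (mutate_seed i S) = mutate_quiver i (fst S)"
  by (simp add: mutate_seed_def)

lemma mutate_along_simps [simp]:
  "mutate_along [] S = S"
  "mutate_along (i # w) S = mutate_along w (mutate_seed i S)"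
  "mutate_along (u @ w) S = mutate_along w (mutate_along u S)"
  by (simp_all add: mutate_along_def)

lemma mutate_along_quiver_simps [simp]:
  "num_exch (fst (mutate_along w S)) = num_exch (fst S)"
  "num_frozen (fst (mutate_along w S)) = num_frozen (fst S)"
  "exch (fst (mutate_along w S)) = exch (fst S)"
  "frozen (fst (mutate_along w S)) = frozen (fst S)"
  by (induction w arbitrary: S) simp_all

text \<open>A mutation changes the variable at an exchangeable vertex only, and it leaves the sets
  of exchangeable and frozen vertices as they are.\<close>

lemma snd_mutate_along_frozen:
  assumes "set w \<subseteq> exch (fst S)" "v \<in> frozen (fst S)"
  shows "snd (mutate_along w S) v = snd S v"
  using assms
  by (induction w arbitrary: S) (auto simp: mutate_seed_def dest: exch_frozen_disjoint)

text \<open>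
  Between two frozen vertices \<open>arrows_relabel\<close> says nothing in an ice quiver, so the product
  \<open>d v * d u\<close> only multiplies the arrows at a frozen vertex by its own factor.
\<close>

locale relabeling =
  fixes \<pi> d :: "nat \<Rightarrow> nat" and Q1 Q2 :: quiver
  assumes same_size: "num_exch Q2 = num_exch Q1" "num_frozen Q2 = num_frozen Q1"
    and permutes: "\<pi> permutes frozen Q1"
    and pos: "d v > 0"
    and exch_one: "v \<in> exch Q1 \<Longrightarrow> d v = 1"
    and arrows_relabel: "arrows Q2 (\<pi> v) (\<pi> u) = d v * d u * arrows Q1 v u"
begin

text \<open>The invariant of simultaneous mutation, with \<open>S\<close> on the side of
  \<open>Q1\<close> and \<open>T\<close> on the side of \<open>Q2\<close>. The clauses on arrows and
  variables range over all natural numbers, junk vertices included, which avoids membership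
  conditions.\<close>

definition related :: "seed \<Rightarrow> seed \<Rightarrow> bool" where
  "related S T \<longleftrightarrow>
     num_exch (fst S) = num_exch Q1 \<and> num_frozen (fst S) = num_frozen Q1 \<and>
     num_exch (fst T) = num_exch Q1 \<and> num_frozen (fst T) = num_frozen Q1 \<and>
     (\<forall>v u. arrows (fst T) (\<pi> v) (\<pi> u) = d v * d u * arrows (fst S) v u) \<and>
     (\<forall>v. relabel \<pi> d (snd S v) = snd T (\<pi> v) ^ d v)"

lemma bij: "bij \<pi>"
  using permutes by (rule permutes_bij)

sublocale field_hom "relabel \<pi> d"
  using bij pos by (rule field_hom_relabel)

lemma fixes_exch: "v \<in> exch Q1 \<Longrightarrow> \<pi> v = v"
  using permutes exch_frozen_disjoint by (simp add: permutes_def)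

lemma relabel_frozen: "\<pi> v \<in> frozen Q1 \<longleftrightarrow> v \<in> frozen Q1"
  using permutes by (rule permutes_in_image)

lemma relabel_verts: "\<pi> v \<in> verts Q1 \<longleftrightarrow> v \<in> verts Q1"
  by (metis Un_iff bij bij_pointE fixes_exch relabel_frozen verts_eq)

lemma related_initial: "related (initial_seed Q1) (initial_seed Q2)"
  by (simp add: related_def initial_seed_def same_size arrows_relabel relabel_indet bij pos)

lemma related_verts:
  assumes "related S T"
  shows "exch (fst S) = exch Q1" "frozen (fst S) = frozen Q1" "verts (fst S) = verts Q1"
    "exch (fst T) = exch Q1" "frozen (fst T) = frozen Q1" "verts (fst T) = verts Q1"
  using assms by (auto simp: related_def exch_def frozen_def verts_def)

text \<open>Since \<open>d i = 1\<close> and \<open>\<pi> i = i\<close>, the matrix entry of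
  \<open>T\<close> at \<open>\<pi> v\<close> and \<open>i\<close> is \<open>d v\<close> times that
  of \<open>S\<close> at \<open>v\<close> and \<open>i\<close>. The factor is positive, so signs
  agree, and it is the very exponent that \<open>relabel\<close> produces at \<open>v\<close>; each
  product of the exchange relation goes to its counterpart.\<close>

lemma relabel_exchanged_var:
  assumes rel: "related S T" and i: "i \<in> exch Q1"
  shows "relabel \<pi> d (exchanged_var S i) = exchanged_var T i"
proof -
  let ?b = "\<lambda>v. exchange_matrix (fst S) v i" and ?c = "\<lambda>v. exchange_matrix (fst T) v i"
  have arr: "arrows (fst T) (\<pi> v) (\<pi> u) = d v * d u * arrows (fst S) v u" for v u
    using rel by (simp add: related_def)
  have var: "relabel \<pi> d (snd S v) = snd T (\<pi> v) ^ d v" for v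
    using rel by (simp add: related_def)
  have c: "?c (\<pi> v) = int (d v) * ?b v" for v
    using arr[of v i] arr[of i v]
    by (simp add: exchange_matrix_def fixes_exch exch_one i right_diff_distrib)
  \<comment> \<open>The sign \<open>s\<close> stands for 1 and -1, so that both products of the
    exchange relation are treated at once.\<close>
  have prod: "relabel \<pi> d (\<Prod>v | v \<in> verts Q1 \<and> s * ?b v > 0. snd S v ^ nat (s * ?b v)) =
      (\<Prod>v | v \<in> verts Q1 \<and> s * ?c v > 0. snd T v ^ nat (s * ?c v))" for s
  proof -
    have s: "s * ?c (\<pi> v) = int (d v) * (s * ?b v)" for v
      by (simp add: c)
    have s_pos: "s * ?c (\<pi> v) > 0 \<longleftrightarrow> s * ?b v > 0" for v
      unfolding s using pos[of v] by (simp add: zero_less_mult_iff)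
    have "bij_betw \<pi> {v \<in> verts Q1. s * ?b v > 0} {v \<in> verts Q1. s * ?c v > 0}"
    proof (rule bij_betw_imageI)
      show "inj_on \<pi> {v \<in> verts Q1. s * ?b v > 0}"
        using bij by (meson bij_is_inj inj_on_subset subset_UNIV)
      show "\<pi> ` {v \<in> verts Q1. s * ?b v > 0} = {v \<in> verts Q1. s * ?c v > 0}"
      proof (intro equalityI subsetI)
        fix u assume u: "u \<in> {v \<in> verts Q1. s * ?c v > 0}"
        obtain v where "u = \<pi> v" using bij by (metis bij_pointE)
        then show "u \<in> \<pi> ` {v \<in> verts Q1. s * ?b v > 0}"
          using u s_pos relabel_verts by blast
      qed (use s_pos relabel_verts in auto)
    qed
    from prod.reindex_bij_betw[OF this, of "\<lambda>v. snd T v ^ nat (s * ?c v)"]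
    show ?thesis
      by (simp add: hom_prod hom_power var s nat_mult_distrib flip: power_mult)
  qed
  show ?thesis
    using prod[of 1] prod[of "-1"] var[of i] related_verts[OF rel]
    by (simp add: exchanged_var_def case_prod_beta hom_add hom_divide fixes_exch exch_one i)
qed

lemma related_mutate_seed:
  assumes rel: "related S T" and i: "i \<in> exch Q1"
  shows "related (mutate_seed i S) (mutate_seed i T)"
proof -
  have arr: "arrows (fst T) (\<pi> v) (\<pi> u) = d v * d u * arrows (fst S) v u" for v u
    using rel by (simp add: related_def)
  have pi_i: "\<pi> v = i \<longleftrightarrow> v = i" for v
    using bij fixes_exch[OF i] by (metis bij_is_inj inj_eq)
  \<comment> \<open>A path through \<open>i\<close> carries the factor \<open>d i\<close> twice, and
    \<open>d i = 1\<close>, so paths scale like direct arrows.\<close>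
  have "arrows (fst T) (\<pi> v) (\<pi> u) + arrows (fst T) (\<pi> v) i * arrows (fst T) i (\<pi> u) =
      d v * d u * (arrows (fst S) v u + arrows (fst S) v i * arrows (fst S) i u)" for v u
    using arr[of v u] arr[of v i] arr[of i u]
    by (simp add: fixes_exch exch_one i algebra_simps)
  \<comment> \<open>Reversal at \<open>i\<close> swaps the arguments, under which
    \<open>d v * d u\<close> is symmetric, and truncated subtraction commutes with multiplication by
    this factor.\<close>
  then have "arrows (mutate_quiver i (fst T)) (\<pi> v) (\<pi> u) =
      d v * d u * arrows (mutate_quiver i (fst S)) v u" for v u
    by (simp add: arrows_mutate_quiver Let_def related_verts[OF rel] relabel_frozen pi_i
        right_diff_distrib' mult.commute[of "d u" "d v"] exch_one[OF i])
  then show ?thesis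
    using rel relabel_exchanged_var[OF rel i]
    by (auto simp: related_def mutate_seed_def pi_i exch_one i)
qed

lemma related_mutate_along:
  assumes "related S T" "set w \<subseteq> exch Q1"
  shows "related (mutate_along w S) (mutate_along w T)"
  using assms by (induction w arbitrary: S T) (simp_all add: related_mutate_seed)

end

section \<open>Coefficient groups and localized algebras\<close>

lemma ambient_simps [simp]:
  "carrier ambient = UNIV" "monoid.mult ambient = (*)" "monoid.one ambient = 1"
  "ring.zero ambient = 0" "ring.add ambient = (+)"
  by (simp_all add: ring_of_type_algebra_def)

lemma field_ambient: "field ambient"
  by (rule field_from_type_algebra)

lemma group_mult_of_ambient: "group (mult_of ambient)"
  using field.field_mult_group[OF field_ambient]
  by (simp add: Ring_Divisibility.mult_of_def Multiplicative_Group.mult_of_def)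

lemma a_inv_ambient [simp]: "a_inv ambient x = - x"
  by (rule abelian_group.minus_equality)
    (use field_ambient in \<open>auto simp: field_def domain_def cring_def ring_def\<close>)

lemma m_inv_ambient:
  assumes "x \<noteq> 0"
  shows "m_inv (mult_of ambient) x = inverse x"
  by (rule group.inv_equality) (use assms group_mult_of_ambient in auto)

lemma cluster_algebra_simps [simp]:
  "seeds (cluster_algebra Q) = seeds_of Q"
  "elements (cluster_algebra Q) =
     generate_ring ambient {x j | Q' x j. (Q', x) \<in> seeds_of Q \<and> j \<in> verts Q'}"
  by (simp_all add: cluster_algebra_def)

lemma initial_seed_in_seeds_of: "initial_seed Q \<in> seeds_of Q"
  unfolding seeds_of_def
  by (rule CollectI, rule exI[of _ "[]"]) (simp add: admissible_def)

text \<open>Frozen variables are never mutated, so no seed adds anything to those of the initial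
  one.\<close>

lemma frozen_variables_cluster_algebra: "frozen_variables (cluster_algebra Q) = indet ` frozen Q"
proof (intro equalityI subsetI)
  fix y assume "y \<in> frozen_variables (cluster_algebra Q)"
  then obtain Q' x j w where *: "y = x j" "j \<in> frozen Q'" "admissible Q w"
    "(Q', x) = mutate_along w (initial_seed Q)"
    by (auto simp: frozen_variables_def seeds_of_def)
  then have "Q' = fst (mutate_along w (initial_seed Q))" "x = snd (mutate_along w (initial_seed Q))"
    by (metis fst_conv, metis snd_conv)
  then show "y \<in> indet ` frozen Q"
    using * snd_mutate_along_frozen[of w "initial_seed Q" j]
    by (simp add: admissible_def initial_seed_def)
next
  fix y assume "y \<in> indet ` frozen Q"
  moreover have "(Q, indet) \<in> seeds_of Q"
    using initial_seed_in_seeds_of[of Q] by (simp add: initial_seed_def)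
  ultimately show "y \<in> frozen_variables (cluster_algebra Q)"
    by (auto simp: frozen_variables_def)
qed

lemma mult_coefficient_group [simp]: "monoid.mult (coefficient_group A) = (*)"
  by (simp add: coefficient_group_def)

lemma carrier_coefficient_group:
  "carrier (coefficient_group (cluster_algebra Q)) =
    generate (mult_of ambient) (indet ` frozen Q)"
proof -
  \<comment> \<open>\<open>subgroup_generated\<close> intersects the generators with the carrier,
    here the nonzero elements; no indeterminate is lost.\<close>
  have "carrier (mult_of ambient) \<inter> indet ` frozen Q = indet ` frozen Q"
    by (auto simp: indet_nonzero)
  then show ?thesis
    by (simp add: coefficient_group_def carrier_subgroup_generated frozen_variables_cluster_algebra)
qed

lemma coefficient_group_nonzero:
  assumes "x \<in> carrier (coefficient_group (cluster_algebra Q))"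
  shows "x \<noteq> 0"
proof -
  have "indet ` frozen Q \<subseteq> carrier (mult_of ambient)"
    by (auto simp: indet_nonzero)
  then show ?thesis
    using group.generate_in_carrier[OF group_mult_of_ambient, of "indet ` frozen Q" x] assms
    by (simp add: carrier_coefficient_group)
qed

lemma coefficient_group_one: "1 \<in> carrier (coefficient_group (cluster_algebra Q))"
  using generate.one[of "mult_of ambient"] by (simp add: carrier_coefficient_group)

lemma coefficient_group_indet:
  "v \<in> frozen Q \<Longrightarrow> indet v \<in> carrier (coefficient_group (cluster_algebra Q))"
  by (simp add: carrier_coefficient_group generate.incl)

lemma coefficient_group_mult:
  "x \<in> carrier (coefficient_group (cluster_algebra Q)) \<Longrightarrow>
   y \<in> carrier (coefficient_group (cluster_algebra Q)) \<Longrightarrow>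
   x * y \<in> carrier (coefficient_group (cluster_algebra Q))"
  using generate.eng[of x "mult_of ambient" "indet ` frozen Q" y]
  by (simp add: carrier_coefficient_group)

lemma coefficient_group_power:
  "x \<in> carrier (coefficient_group (cluster_algebra Q)) \<Longrightarrow>
   x ^ n \<in> carrier (coefficient_group (cluster_algebra Q))"
  by (induction n) (simp_all add: coefficient_group_one coefficient_group_mult)

lemma coefficient_group_inverse:
  assumes "x \<in> carrier (coefficient_group (cluster_algebra Q))"
  shows "inverse x \<in> carrier (coefficient_group (cluster_algebra Q))"
proof -
  have "m_inv (mult_of ambient) x \<in> carrier (coefficient_group (cluster_algebra Q))"
    using assms unfolding carrier_coefficient_group
    by (intro group.generate_m_inv_closed[OF group_mult_of_ambient]) (auto simp: indet_nonzero)
  then show ?thesis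
    using coefficient_group_nonzero[OF assms] by (simp add: m_inv_ambient)
qed

text \<open>Induction over \<open>generate\<close> has a case for inverses of generators. Closure
  under all inverses replaces it, which is natural for every property the rule is applied
  to.\<close>

lemma coefficient_group_induct [consumes 1, case_names one indet inverse mult]:
  assumes "x \<in> carrier (coefficient_group (cluster_algebra Q))"
    and one: "P 1" and indet: "\<And>v. v \<in> frozen Q \<Longrightarrow> P (indet v)"
    and inverse: "\<And>x. P x \<Longrightarrow> P (inverse x)"
    and mult: "\<And>x y. P x \<Longrightarrow> P y \<Longrightarrow> P (x * y)"
  shows "P x"
  using assms(1) unfolding carrier_coefficient_group
proof (induction x rule: generate.induct)
  case (inv h)
  then obtain v where "v \<in> frozen Q" "h = indet v" by blast
  then show ?case
    using inverse[OF indet] by (simp only: m_inv_ambient[OF indet_nonzero])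
qed (use one indet mult in \<open>auto simp only: ambient_simps one_mult_of mult_mult_of\<close>)

section \<open>Closure properties of the cluster algebra and its localization\<close>

lemma elements_one: "1 \<in> elements (cluster_algebra Q)"
  using generate_ring.one[of ambient] by simp

lemma elements_mult:
  "x \<in> elements (cluster_algebra Q) \<Longrightarrow> y \<in> elements (cluster_algebra Q) \<Longrightarrow>
   x * y \<in> elements (cluster_algebra Q)"
  using generate_ring.eng_mult[of x ambient _ y] by simp

lemma elements_add:
  "x \<in> elements (cluster_algebra Q) \<Longrightarrow> y \<in> elements (cluster_algebra Q) \<Longrightarrow>
   x + y \<in> elements (cluster_algebra Q)"
  using generate_ring.eng_add[of x ambient _ y] by simp

lemma elements_power: "x \<in> elements (cluster_algebra Q) \<Longrightarrow> x ^ n \<in> elements (cluster_algebra Q)"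
  by (induction n) (simp_all add: elements_one elements_mult del: cluster_algebra_simps)

lemma elements_cluster_variable:
  assumes "S \<in> seeds_of Q" "v \<in> verts (fst S)"
  shows "snd S v \<in> elements (cluster_algebra Q)"
  using assms generate_ring.incl by (cases S) (auto intro!: generate_ring.incl)

lemma localized_algebra_simps [simp]:
  "monoid.mult (localized_algebra A) = (*)" "monoid.one (localized_algebra A) = 1"
  "ring.add (localized_algebra A) = (+)"
  by (simp_all add: localized_algebra_def)

lemma carrier_localized_algebra:
  "carrier (localized_algebra A) = {a / p | a p. a \<in> elements A \<and> p \<in> carrier (coefficient_group A)}"
  by (simp add: localized_algebra_def)

lemma elements_indet:
  assumes "v \<in> frozen Q"
  shows "indet v \<in> elements (cluster_algebra Q)"
  using elements_cluster_variable[OF initial_seed_in_seeds_of, of v Q] assms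
  by (simp add: initial_seed_def verts_eq del: cluster_algebra_simps)

text \<open>Common denominators exist because elements of the coefficient group are quotients of monomials.\<close>

lemma coefficient_group_fraction:
  assumes "x \<in> carrier (coefficient_group (cluster_algebra Q))"
  shows "\<exists>a b. x = a / b \<and> a \<noteq> 0 \<and> b \<noteq> 0 \<and>
    a \<in> elements (cluster_algebra Q) \<inter> carrier (coefficient_group (cluster_algebra Q)) \<and>
    b \<in> elements (cluster_algebra Q) \<inter> carrier (coefficient_group (cluster_algebra Q))"
  using assms
proof (induction rule: coefficient_group_induct)
  case one
  show ?case
    by (intro exI[of _ 1]) (simp add: elements_one coefficient_group_one del: cluster_algebra_simps)
next
  case (indet v)
  then show ?case
    by (intro exI[of _ "indet v"] exI[of _ 1])
      (simp add: elements_one coefficient_group_one coefficient_group_indet indet_nonzero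
        elements_indet del: cluster_algebra_simps)
next
  case (inverse x)
  then obtain a b where "x = a / b" "a \<noteq> 0" "b \<noteq> 0"
    "a \<in> elements (cluster_algebra Q) \<inter> carrier (coefficient_group (cluster_algebra Q))"
    "b \<in> elements (cluster_algebra Q) \<inter> carrier (coefficient_group (cluster_algebra Q))"
    by blast
  then show ?case
    by (intro exI[of _ b] exI[of _ a]) (simp add: inverse_divide del: cluster_algebra_simps)
next
  case (mult x y)
  then obtain a b a' b' where "x = a / b" "y = a' / b'" "a \<noteq> 0" "b \<noteq> 0" "a' \<noteq> 0" "b' \<noteq> 0"
    "a \<in> elements (cluster_algebra Q) \<inter> carrier (coefficient_group (cluster_algebra Q))"
    "b \<in> elements (cluster_algebra Q) \<inter> carrier (coefficient_group (cluster_algebra Q))"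
    "a' \<in> elements (cluster_algebra Q) \<inter> carrier (coefficient_group (cluster_algebra Q))"
    "b' \<in> elements (cluster_algebra Q) \<inter> carrier (coefficient_group (cluster_algebra Q))"
    by blast
  then show ?case
    by (intro exI[of _ "a * a'"] exI[of _ "b * b'"])
      (simp add: elements_mult coefficient_group_mult del: cluster_algebra_simps)
qed

lemma elements_subset_localized_algebra:
  "elements (cluster_algebra Q) \<subseteq> carrier (localized_algebra (cluster_algebra Q))"
proof
  fix a assume "a \<in> elements (cluster_algebra Q)"
  then show "a \<in> carrier (localized_algebra (cluster_algebra Q))"
    unfolding carrier_localized_algebra
    by (intro CollectI exI[of _ a] exI[of _ 1]) (simp add: coefficient_group_one)
qed

lemma coefficient_group_subset_localized_algebra:
  "carrier (coefficient_group (cluster_algebra Q)) \<subseteq> carrier (localized_algebra (cluster_algebra Q))"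
proof
  fix p assume "p \<in> carrier (coefficient_group (cluster_algebra Q))"
  then show "p \<in> carrier (localized_algebra (cluster_algebra Q))"
    unfolding carrier_localized_algebra
    using elements_one coefficient_group_inverse
    by (intro CollectI exI[of _ 1] exI[of _ "inverse p"]) (simp add: divide_inverse)
qed

lemma localized_algebra_one: "1 \<in> carrier (localized_algebra (cluster_algebra Q))"
  using elements_one elements_subset_localized_algebra by blast

text \<open>Writing the denominator as a quotient \<open>b / c\<close> of elements of the algebra
  turns \<open>a / p\<close> into \<open>a * c / b\<close>. Sums need denominators in the algebra
  itself, because each of them multiplies the other numerator.\<close>

lemma localized_algebra_numerator:
  assumes "x \<in> carrier (localized_algebra (cluster_algebra Q))"
  obtains a p where "x = a / p" "p \<noteq> 0" "a \<in> elements (cluster_algebra Q)"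
    "p \<in> elements (cluster_algebra Q)" "p \<in> carrier (coefficient_group (cluster_algebra Q))"
proof -
  obtain a p where a: "x = a / p" "a \<in> elements (cluster_algebra Q)"
    and p: "p \<in> carrier (coefficient_group (cluster_algebra Q))"
    using assms unfolding carrier_localized_algebra by blast
  obtain b c where "p = b / c" "b \<noteq> 0"
    "b \<in> elements (cluster_algebra Q)" "b \<in> carrier (coefficient_group (cluster_algebra Q))"
    "c \<in> elements (cluster_algebra Q)"
    using coefficient_group_fraction[OF p] by blast
  with a show ?thesis
    by (intro that[of "a * c" b]) (simp_all add: elements_mult del: cluster_algebra_simps)
qed

lemma localized_algebra_mult:
  assumes "x \<in> carrier (localized_algebra (cluster_algebra Q))"
    and "y \<in> carrier (localized_algebra (cluster_algebra Q))"
  shows "x * y \<in> carrier (localized_algebra (cluster_algebra Q))"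
proof -
  obtain a p where x: "x = a / p" "a \<in> elements (cluster_algebra Q)"
    "p \<in> carrier (coefficient_group (cluster_algebra Q))"
    using assms(1) by (rule localized_algebra_numerator)
  obtain b q where y: "y = b / q" "b \<in> elements (cluster_algebra Q)"
    "q \<in> carrier (coefficient_group (cluster_algebra Q))"
    using assms(2) by (rule localized_algebra_numerator)
  from x y show ?thesis
    unfolding carrier_localized_algebra
    by (intro CollectI exI[of _ "a * b"] exI[of _ "p * q"])
      (simp add: elements_mult coefficient_group_mult del: cluster_algebra_simps)
qed

lemma localized_algebra_add:
  assumes "x \<in> carrier (localized_algebra (cluster_algebra Q))"
    and "y \<in> carrier (localized_algebra (cluster_algebra Q))"
  shows "x + y \<in> carrier (localized_algebra (cluster_algebra Q))"
proof -
  obtain a p where x: "x = a / p" "p \<noteq> 0" "a \<in> elements (cluster_algebra Q)"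
    "p \<in> elements (cluster_algebra Q)" "p \<in> carrier (coefficient_group (cluster_algebra Q))"
    using assms(1) by (rule localized_algebra_numerator)
  obtain b q where y: "y = b / q" "q \<noteq> 0" "b \<in> elements (cluster_algebra Q)"
    "q \<in> elements (cluster_algebra Q)" "q \<in> carrier (coefficient_group (cluster_algebra Q))"
    using assms(2) by (rule localized_algebra_numerator)
  from x y show ?thesis
    unfolding carrier_localized_algebra
    by (intro CollectI exI[of _ "a * q + b * p"] exI[of _ "p * q"])
      (simp add: add_frac_eq elements_mult elements_add coefficient_group_mult del: cluster_algebra_simps)
qed

section \<open>Relabellings are coefficient specializations\<close>

context relabeling
begin

lemma exch_Q2: "exch Q2 = exch Q1" and frozen_Q2: "frozen Q2 = frozen Q1"
  by (simp_all add: exch_def frozen_def same_size)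

lemma related_seed:
  assumes "set w \<subseteq> exch Q1"
  shows "related (mutate_along w (initial_seed Q1)) (mutate_along w (initial_seed Q2))"
  using related_initial assms by (rule related_mutate_along)

lemma relabel_coefficient_group:
  assumes "x \<in> carrier (coefficient_group (cluster_algebra Q1))"
  shows "relabel \<pi> d x \<in> carrier (coefficient_group (cluster_algebra Q2))"
  using assms
proof (induction rule: coefficient_group_induct)
  case (indet v)
  then show ?case
    by (simp add: relabel_indet bij pos coefficient_group_power coefficient_group_indet
        frozen_Q2 relabel_frozen)
qed (simp_all add: hom_one hom_inverse hom_mult coefficient_group_one
      coefficient_group_inverse coefficient_group_mult)

text \<open>A generator is the variable at some \<open>v\<close> after mutating along some
  \<open>w\<close>. By the invariant its image is a power of the variable at \<open>\<pi> v\<close>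
  after mutating \<open>Q2\<close> along the same \<open>w\<close>.\<close>

lemma relabel_elements:
  assumes "x \<in> elements (cluster_algebra Q1)"
  shows "relabel \<pi> d x \<in> elements (cluster_algebra Q2)"
  using assms unfolding cluster_algebra_simps(2)[of Q1]
proof (induction x rule: generate_ring.induct)
  case (incl h)
  then obtain w v where w: "set w \<subseteq> exch Q1"
    and h: "h = snd (mutate_along w (initial_seed Q1)) v"
      "v \<in> verts (fst (mutate_along w (initial_seed Q1)))"
    unfolding seeds_of_def admissible_def
    by (smt (verit) fst_conv mem_Collect_eq snd_conv)
  let ?T = "mutate_along w (initial_seed Q2)"
  have "?T \<in> seeds_of Q2"
    using w by (auto simp: seeds_of_def admissible_def exch_Q2)
  moreover have "\<pi> v \<in> verts (fst ?T)"
    using h related_verts[OF related_seed[OF w]] relabel_verts by simp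
  moreover have "relabel \<pi> d h = snd ?T (\<pi> v) ^ d v"
    using related_seed[OF w] h by (simp add: related_def)
  ultimately show ?case
    using elements_cluster_variable elements_power by metis
next
  case (a_inv h)
  then show ?case
    using generate_ring.a_inv[of "relabel \<pi> d h" ambient] by (simp add: hom_uminus)
next
  case (eng_add h k)
  then show ?case
    using generate_ring.eng_add[of "relabel \<pi> d h" ambient _ "relabel \<pi> d k"] by (simp add: hom_add)
qed (use elements_one elements_mult in \<open>simp_all add: hom_one hom_mult del: cluster_algebra_simps\<close>)

text \<open>The invariant starts at the initial seeds, but the roots may be other seeds. With both
  roots reached along the same \<open>w0\<close>, mutating them along \<open>w\<close> amounts to
  mutating the initial seeds along \<open>w0 @ w\<close>.\<close>

lemma coefficient_specialization_relabel:
  assumes w0: "set w0 \<subseteq> exch Q1"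
    and roots: "mutate_along w0 (initial_seed Q1) = (Q1, x1)" "mutate_along w0 (initial_seed Q2) = (Q2, x2)"
  shows "coefficient_specialization (Q1, x1, cluster_algebra Q1) (Q2, x2, cluster_algebra Q2)
    (relabel \<pi> d)"
  unfolding coefficient_specialization_def prod.case
proof (intro conjI allI impI ballI)
  show "relabel \<pi> d \<in> hom (coefficient_group (cluster_algebra Q1)) (coefficient_group (cluster_algebra Q2))"
    by (rule homI) (simp_all add: relabel_coefficient_group hom_mult)
  show "relabel \<pi> d \<in> ring_hom (localized_algebra (cluster_algebra Q1)) (localized_algebra (cluster_algebra Q2))"
  proof (rule ring_hom_memI)
    fix x assume "x \<in> carrier (localized_algebra (cluster_algebra Q1))"
    then show "relabel \<pi> d x \<in> carrier (localized_algebra (cluster_algebra Q2))"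
      unfolding carrier_localized_algebra
      using relabel_elements relabel_coefficient_group hom_divide by blast
  qed (simp_all add: hom_mult hom_add hom_one)
next
  fix w i assume w: "admissible Q1 w" and i: "i \<in> exch Q1"
  have "set (w0 @ w) \<subseteq> exch Q1"
    using w0 w by (simp add: admissible_def)
  from related_seed[OF this]
  have "related (mutate_along w (Q1, x1)) (mutate_along w (Q2, x2))"
    by (simp add: roots)
  then show "relabel \<pi> d (snd (mutate_along w (Q1, x1)) i) = snd (mutate_along w (Q2, x2)) i"
    using fixes_exch[OF i] exch_one[OF i] unfolding related_def by (metis power_one_right)
qed

end

section \<open>Uniqueness of specializations out of a universal root\<close>

definition universal_root :: "quiver \<Rightarrow> rooted \<Rightarrow> bool" where
  "universal_root Q R \<longleftrightarrow> R \<in> RCA Q \<and>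
     (\<forall>R' \<in> RCA Q. \<exists>!\<phi>. \<phi> \<in> extensional (carrier (localized_algebra (snd (snd R)))) \<and>
        coefficient_specialization R R' \<phi>)"

text \<open>The root has quiver \<open>Q'\<close>, but its cluster need not be the initial one;
  \<open>w\<close> records how it arises from the initial seed.\<close>

lemma RCA_E:
  assumes "(Q', x', A) \<in> RCA Q"
  obtains w where "ice_quiver Q'" "principal_part Q' = Q" "A = cluster_algebra Q'"
    "set w \<subseteq> exch Q'" "mutate_along w (initial_seed Q') = (Q', x')"
proof -
  have "(Q', x') \<in> seeds_of Q'"
    using assms by (auto simp: RCA_def rooted_cluster_algebra_def)
  then obtain w where "set w \<subseteq> exch Q'" "mutate_along w (initial_seed Q') = (Q', x')"
    unfolding seeds_of_def admissible_def by auto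
  then show ?thesis
    using assms by (intro that) (auto simp: RCA_def)
qed

lemma RCA_I:
  assumes "ice_quiver Q'" "principal_part Q' = Q"
    "set w \<subseteq> exch Q'" "mutate_along w (initial_seed Q') = (Q', x')"
  shows "(Q', x', cluster_algebra Q') \<in> RCA Q"
proof -
  have "(Q', x') \<in> seeds_of Q'"
    unfolding seeds_of_def admissible_def using assms(3) assms(4)[symmetric] by blast
  then show ?thesis
    using assms by (simp add: RCA_def rooted_cluster_algebra_def)
qed

text \<open>Coefficients and cluster variables lie in the localized algebra, which is closed under
  sums and products, so only the values there matter. This allows passing from a total map to its
  restriction, which is extensional.\<close>

lemma coefficient_specialization_cong:
  assumes spec: "coefficient_specialization (Q', x', A) R'' \<phi>" and "(Q', x', A) \<in> RCA Q"
    and eq: "\<And>x. x \<in> carrier (localized_algebra A) \<Longrightarrow> \<psi> x = \<phi> x"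
  shows "coefficient_specialization (Q', x', A) R'' \<psi>"
proof -
  obtain w0 where A: "A = cluster_algebra Q'"
    and w0: "set w0 \<subseteq> exch Q'" "mutate_along w0 (initial_seed Q') = (Q', x')"
    by (rule RCA_E[OF assms(2)])
  obtain Q'' x'' A'' where R'': "R'' = (Q'', x'', A'')"
    by (metis prod_cases3)
  have cg: "\<psi> x = \<phi> x" if "x \<in> carrier (coefficient_group A)" for x
    using that eq coefficient_group_subset_localized_algebra A by blast
  have var: "\<psi> (snd (mutate_along w (Q', x')) i) = \<phi> (snd (mutate_along w (Q', x')) i)"
    if "admissible Q' w" "i \<in> exch Q'" for w i
  proof -
    \<comment> \<open>What is reached from the root along \<open>w\<close> is reached from the
      initial seed along \<open>w0 @ w\<close>, hence is a seed of the algebra.\<close>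
    have "mutate_along (w0 @ w) (initial_seed Q') \<in> seeds_of Q'"
      using w0(1) that(1) unfolding seeds_of_def admissible_def
      by (intro CollectI exI[of _ "w0 @ w"]) simp
    moreover have "i \<in> verts (fst (mutate_along w (Q', x')))"
      using that(2) by (simp add: verts_eq)
    ultimately have "snd (mutate_along w (Q', x')) i \<in> elements A"
      using elements_cluster_variable[of "mutate_along w (Q', x')"] by (simp add: w0(2) A del: cluster_algebra_simps)
    then show ?thesis
      using eq elements_subset_localized_algebra A by blast
  qed
  have hom1: "\<psi> \<in> hom (coefficient_group A) (coefficient_group A'')"
    if "\<phi> \<in> hom (coefficient_group A) (coefficient_group A'')"
  proof (rule homI)
    fix x y assume xy: "x \<in> carrier (coefficient_group A)" "y \<in> carrier (coefficient_group A)"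
    then have "x * y \<in> carrier (coefficient_group A)"
      unfolding A by (rule coefficient_group_mult)
    then show "\<psi> (x \<otimes>\<^bsub>coefficient_group A\<^esub> y) = \<psi> x \<otimes>\<^bsub>coefficient_group A''\<^esub> \<psi> y"
      using hom_mult[OF that xy] xy by (simp add: cg)
  next
    fix x assume "x \<in> carrier (coefficient_group A)"
    then show "\<psi> x \<in> carrier (coefficient_group A'')"
      using hom_carrier[OF that] by (auto simp: cg)
  qed
  have hom2: "\<psi> \<in> ring_hom (localized_algebra A) (localized_algebra A'')"
    if phi: "\<phi> \<in> ring_hom (localized_algebra A) (localized_algebra A'')"
  proof (rule ring_hom_memI)
    show "\<psi> \<one>\<^bsub>localized_algebra A\<^esub> = \<one>\<^bsub>localized_algebra A''\<^esub>"
      using ring_hom_one[OF phi] by (simp add: eq A localized_algebra_one)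
  next
    fix x y assume xy: "x \<in> carrier (localized_algebra A)" "y \<in> carrier (localized_algebra A)"
    show "\<psi> x \<in> carrier (localized_algebra A'')"
      using ring_hom_closed[OF phi xy(1)] by (simp add: eq xy)
    show "\<psi> (x \<otimes>\<^bsub>localized_algebra A\<^esub> y) = \<psi> x \<otimes>\<^bsub>localized_algebra A''\<^esub> \<psi> y"
      using ring_hom_mult[OF phi xy] localized_algebra_mult[OF xy[unfolded A]] by (simp add: eq xy flip: A)
    show "\<psi> (x \<oplus>\<^bsub>localized_algebra A\<^esub> y) = \<psi> x \<oplus>\<^bsub>localized_algebra A''\<^esub> \<psi> y"
      using ring_hom_add[OF phi xy] localized_algebra_add[OF xy[unfolded A]] by (simp add: eq xy flip: A)
  qed
  show ?thesis
    using spec unfolding R'' coefficient_specialization_def prod.case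
    using var hom1 hom2 by simp
qed

lemma coefficient_specialization_comp:
  assumes "coefficient_specialization (Q', x', A') (Q'', x'', A'') \<phi>"
    and "coefficient_specialization (Q'', x'', A'') (Q''', x''', A''') \<psi>"
    and "exch Q'' = exch Q'"
  shows "coefficient_specialization (Q', x', A') (Q''', x''', A''') (\<psi> \<circ> \<phi>)"
  using assms unfolding coefficient_specialization_def prod.case admissible_def
  by (auto intro: hom_compose ring_hom_trans)

lemma coefficient_specialization_id:
  "coefficient_specialization (Q', x', A') (Q', x', A') id"
  by (auto simp: coefficient_specialization_def hom_def ring_hom_def)

text \<open>Universality speaks of extensional maps; the restrictions of both maps are extensional
  specializations, hence equal.\<close>

lemma universal_unique:
  assumes univ: "universal_root Q (Qu, xu, A)" and "R' \<in> RCA Q"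
    and \<phi>: "coefficient_specialization (Qu, xu, A) R' \<phi>"
    and \<psi>: "coefficient_specialization (Qu, xu, A) R' \<psi>"
    and x: "x \<in> carrier (localized_algebra A)"
  shows "\<phi> x = \<psi> x"
proof -
  let ?r = "\<lambda>f. restrict f (carrier (localized_algebra A))"
  have R: "(Qu, xu, A) \<in> RCA Q"
    using univ by (simp add: universal_root_def)
  have "coefficient_specialization (Qu, xu, A) R' (?r \<phi>)" "coefficient_specialization (Qu, xu, A) R' (?r \<psi>)"
    by (rule coefficient_specialization_cong[OF \<phi> R], simp,
        rule coefficient_specialization_cong[OF \<psi> R], simp)
  then have "?r \<phi> = ?r \<psi>"
    using univ \<open>R' \<in> RCA Q\<close> unfolding universal_root_def by (metis restrict_extensional snd_conv)
  then show ?thesis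
    using x by (metis restrict_apply')
qed

text \<open>The identity is a specialization too. Both contradictions below come from an
  endomorphism that cannot fix some frozen variable.\<close>

lemma universal_endomorphism:
  assumes univ: "universal_root Q (Qu, xu, A)"
    and "coefficient_specialization (Qu, xu, A) (Qu, xu, A) \<phi>"
    and "v \<in> frozen Qu"
  shows "\<phi> (indet v) = indet v"
proof -
  have R: "(Qu, xu, A) \<in> RCA Q"
    using univ by (simp add: universal_root_def)
  then have "A = cluster_algebra Qu"
    by (rule RCA_E)
  then have "indet v \<in> carrier (localized_algebra A)"
    using coefficient_group_indet[OF assms(3)] coefficient_group_subset_localized_algebra by blast
  from universal_unique[OF univ R assms(2) coefficient_specialization_id this]
  show ?thesis by simp
qed

section \<open>Prime gluing freeness\<close>

text \<open>The arrow counts of \<open>Q1\<close> before and after mutation agree once multiplied by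
  the positive factors \<open>d v * d u\<close>, and these cancel. A sequence leading to a root over
  \<open>Q2\<close> thus leads to one over \<open>Q1\<close>, as membership in \<open>RCA\<close>
  demands.\<close>

lemma (in relabeling) root_relabel:
  assumes "set w \<subseteq> exch Q1" "mutate_along w (initial_seed Q2) = (Q2, x2)"
  obtains x1 where "mutate_along w (initial_seed Q1) = (Q1, x1)"
proof -
  let ?S = "mutate_along w (initial_seed Q1)"
  have rel: "related ?S (Q2, x2)"
    using related_seed[OF assms(1)] assms(2) by simp
  have "arrows (fst ?S) v u = arrows Q1 v u" for v u
  proof -
    have "d v * d u * arrows (fst ?S) v u = d v * d u * arrows Q1 v u"
      using rel arrows_relabel[of v u, symmetric] by (simp only: related_def fst_conv)
    then show ?thesis
      using pos[of v] pos[of u] by simp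
  qed
  then have "fst ?S = Q1"
    using rel by (intro quiver.equality ext) (simp_all add: related_def)
  then show ?thesis
    by (intro that[of "snd ?S"]) (simp add: prod_eq_iff)
qed

lemma ice_quiverD:
  assumes "ice_quiver Q"
  shows "j \<notin> verts Q \<or> k \<notin> verts Q \<Longrightarrow> arrows Q j k = 0"
    and "arrows Q j j = 0"
    and "arrows Q j k = 0 \<or> arrows Q k j = 0"
    and "j \<in> frozen Q \<Longrightarrow> k \<in> frozen Q \<Longrightarrow> arrows Q j k = 0"
    and "connected_quiver Q" and "connected_quiver (principal_part Q)"
  using assms by (simp_all add: ice_quiver_def)

text \<open>A walk joins \<open>j\<close> to an exchangeable vertex. Its first edge already ends at
  an exchangeable vertex, since no arrows join frozen ones, and without 2-cycles its arrows do not
  cancel in the matrix.\<close>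

lemma frozen_vertex_row_nonzero:
  assumes Q: "ice_quiver Q" and j: "j \<in> frozen Q"
  shows "\<exists>i\<in>exch Q. exchange_matrix Q j i \<noteq> 0"
proof -
  have "verts (principal_part Q) \<noteq> {}"
    using ice_quiverD(6)[OF Q] by (simp add: connected_quiver_def)
  then obtain i where i: "i \<in> exch Q"
    by (auto simp: verts_def principal_part_def exch_def)
  let ?R = "{(a, b). a \<in> verts Q \<and> b \<in> verts Q \<and> (arrows Q a b > 0 \<or> arrows Q b a > 0)}"
  have "(j, i) \<in> ?R\<^sup>*"
    using ice_quiverD(5)[OF Q] i j by (simp add: connected_quiver_def verts_eq)
  moreover have "j \<noteq> i"
    using i j exch_frozen_disjoint by blast
  ultimately obtain k where k: "(j, k) \<in> ?R"
    by (cases rule: converse_rtranclE) blast+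
  have "k \<notin> frozen Q"
  proof
    assume "k \<in> frozen Q"
    with ice_quiverD(4)[OF Q] j k show False by simp
  qed
  with k have "k \<in> exch Q"
    by (simp add: verts_eq)
  moreover have "exchange_matrix Q j k \<noteq> 0"
    using k ice_quiverD(3)[OF Q, of j k] by (auto simp: exchange_matrix_def)
  ultimately show ?thesis by blast
qed

lemma arrows_outside_exch:
  assumes "ice_quiver Q" "j \<in> frozen Q" "v \<notin> exch Q"
  shows "arrows Q j v = 0" "arrows Q v j = 0"
proof -
  have "v \<notin> verts Q \<or> v \<in> frozen Q"
    using assms(3) by (simp add: verts_eq)
  then show "arrows Q j v = 0" "arrows Q v j = 0"
    using ice_quiverD(1,4)[OF assms(1)] assms(2) by blast+
qed

text \<open>Without 2-cycles one of the two counts is zero, so the positive and negative parts of an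
  entry recover both. Statements on rows thereby transfer to arrows.\<close>

lemma exchange_matrix_arrows:
  assumes "ice_quiver Q"
  shows "arrows Q j v = nat (exchange_matrix Q j v)" "arrows Q v j = nat (- exchange_matrix Q j v)"
proof -
  have "arrows Q j v = 0 \<or> arrows Q v j = 0"
    using assms by (rule ice_quiverD)
  then show "arrows Q j v = nat (exchange_matrix Q j v)" "arrows Q v j = nat (- exchange_matrix Q j v)"
    by (auto simp: exchange_matrix_def)
qed

text \<open>With this form, clearing denominators turns equations between coefficients into
  equations between exponent vectors of natural numbers.\<close>

lemma coefficient_group_monomial:
  assumes "x \<in> carrier (coefficient_group (cluster_algebra Q))"
  obtains m n where "x = monomial m / monomial n"
proof -
  have "\<exists>m n. x = monomial m / monomial n"
    using assms
  proof (induction rule: coefficient_group_induct)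
    case one
    then show ?case
      by (intro exI[of _ 0]) (simp add: monomial_0)
  next
    case (indet v)
    then show ?case
      by (metis div_by_1 indet_monomial monomial_0)
  next
    case (inverse x)
    then show ?case
      by (metis inverse_divide)
  next
    case (mult x y)
    then show ?case
      by (metis monomial_add times_divide_times_eq)
  qed
  then show ?thesis
    using that by blast
qed

definition divide_arrows :: "nat \<Rightarrow> nat \<Rightarrow> quiver \<Rightarrow> quiver" where
  "divide_arrows j p Q =
     Q\<lparr>arrows := (\<lambda>v u. if v = j \<or> u = j then arrows Q v u div p else arrows Q v u)\<rparr>"

lemma divide_arrows_simps:
  "num_exch (divide_arrows j p Q) = num_exch Q"
  "num_frozen (divide_arrows j p Q) = num_frozen Q"
  "exch (divide_arrows j p Q) = exch Q"
  "frozen (divide_arrows j p Q) = frozen Q"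
  "verts (divide_arrows j p Q) = verts Q"
  by (simp_all add: divide_arrows_def exch_def frozen_def verts_def)

lemma ice_quiver_divide_arrows:
  assumes Q: "ice_quiver Q" and j: "j \<in> frozen Q" and p: "p > 0"
    and dvd: "\<And>v. p dvd arrows Q j v" "\<And>v. p dvd arrows Q v j"
  shows "ice_quiver (divide_arrows j p Q)" "principal_part (divide_arrows j p Q) = principal_part Q"
proof -
  show pp: "principal_part (divide_arrows j p Q) = principal_part Q"
    using exch_frozen_disjoint[of j Q] j
    by (auto simp: principal_part_def divide_arrows_simps intro!: ext) (auto simp: divide_arrows_def)
  have zero: "arrows (divide_arrows j p Q) v u = 0 \<longleftrightarrow> arrows Q v u = 0" for v u
    using dvd p by (auto simp: divide_arrows_def dvd_div_eq_0_iff)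
  have "connected_quiver (divide_arrows j p Q)"
    using Q by (simp add: ice_quiver_def connected_quiver_def divide_arrows_simps zero
        flip: neq0_conv)
  then show "ice_quiver (divide_arrows j p Q)"
    using Q by (simp add: ice_quiver_def divide_arrows_simps zero pp)
qed

lemma universal_prime_vertex:
  assumes univ: "universal_root Q (Qu, xu, A)" and j: "j \<in> frozen Qu"
  shows "prime_vertex Qu j"
proof (rule ccontr)
  assume not_prime: "\<not> prime_vertex Qu j"
  define p where "p = nat (Gcd (exchange_matrix Qu j ` exch Qu))"
  have R: "(Qu, xu, A) \<in> RCA Q"
    using univ by (simp add: universal_root_def)
  from R obtain w where Qu: "ice_quiver Qu" "principal_part Qu = Q" "A = cluster_algebra Qu"
    and w: "set w \<subseteq> exch Qu" "mutate_along w (initial_seed Qu) = (Qu, xu)"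
    by (rule RCA_E)
  \<comment> \<open>A zero row would have greatest common divisor 0, by which one cannot
    divide.\<close>
  have "Gcd (exchange_matrix Qu j ` exch Qu) \<noteq> 0"
    using frozen_vertex_row_nonzero[OF Qu(1) j] by auto
  moreover have "Gcd (exchange_matrix Qu j ` exch Qu) \<ge> 0"
    by (rule Gcd_int_greater_eq_0)
  moreover have "Gcd (exchange_matrix Qu j ` exch Qu) \<noteq> 1"
    using not_prime j by (simp add: prime_vertex_def)
  ultimately have p: "p > 0" "p \<noteq> 1"
    unfolding p_def by linarith+
  have row_dvd: "int p dvd exchange_matrix Qu j v" for v
  proof (cases "v \<in> exch Qu")
    case True
    then show ?thesis
      by (simp add: p_def)
  next
    case False
    then show ?thesis
      using arrows_outside_exch[OF Qu(1) j] by (simp add: exchange_matrix_def)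
  qed
  have nat_dvd: "p dvd nat z" if "int p dvd z" for z
    using that by (cases "z \<ge> 0") (auto simp: int_dvd_int_iff[symmetric])
  have dvd: "p dvd arrows Qu j v" "p dvd arrows Qu v j" for v
    using row_dvd[of v] by (simp_all add: exchange_matrix_arrows(1)[OF Qu(1), of j v]
        exchange_matrix_arrows(2)[OF Qu(1), of v j] nat_dvd)
  define d where "d v = (if v = j then p else 1)" for v
  define Q' where "Q' = divide_arrows j p Qu"
  interpret relabeling id d Q' Qu
  proof
    \<comment> \<open>If \<open>v\<close> and \<open>u\<close> both equal \<open>j\<close>, the
      factor is \<open>p * p\<close>; the equation still holds because \<open>j\<close> carries no
      loop.\<close>
    show "arrows Qu (id v) (id u) = d v * d u * arrows Q' v u" for v u
      using dvd p ice_quiverD(2)[OF Qu(1)] by (auto simp: d_def Q'_def divide_arrows_def)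
  qed (use p j in \<open>auto simp: Q'_def divide_arrows_simps d_def permutes_id dest: exch_frozen_disjoint\<close>)
  have w': "set w \<subseteq> exch Q'"
    using w by (simp add: Q'_def divide_arrows_simps)
  obtain x' where x': "mutate_along w (initial_seed Q') = (Q', x')"
    using w' w(2) by (rule root_relabel)
  have R': "(Q', x', cluster_algebra Q') \<in> RCA Q"
    using ice_quiver_divide_arrows[OF Qu(1) j p(1) dvd] Qu(2) w' x'
    by (intro RCA_I) (simp_all add: Q'_def)
  obtain \<phi> where \<phi>: "coefficient_specialization (Qu, xu, A) (Q', x', cluster_algebra Q') \<phi>"
    using univ R' unfolding universal_root_def by blast
  have "coefficient_specialization (Qu, xu, A) (Qu, xu, A) (relabel id d \<circ> \<phi>)"
    using \<phi> coefficient_specialization_relabel[OF w' x' w(2)] exch_Q2[symmetric]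
    unfolding Qu(3) by (rule coefficient_specialization_comp)
  from universal_endomorphism[OF univ this j]
  have id: "relabel id d (\<phi> (indet j)) = indet j"
    by simp
  have "\<phi> \<in> hom (coefficient_group A) (coefficient_group (cluster_algebra Q'))"
    using \<phi> by (simp add: coefficient_specialization_def)
  then have "\<phi> (indet j) \<in> carrier (coefficient_group (cluster_algebra Q'))"
    using coefficient_group_indet[OF j] unfolding Qu(3) hom_def by blast
  then obtain m n where "\<phi> (indet j) = monomial m / monomial n"
    by (rule coefficient_group_monomial)
  then have "monomial (relabel_exponent id d m) = monomial (Poly_Mapping.single j 1 + relabel_exponent id d n)"
    using id by (simp add: hom_divide relabel_monomial bij pos indet_monomial monomial_add
        divide_eq_eq monomial_nonzero)
  \<comment> \<open>Exponents at \<open>j\<close> are compared: those in the image of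
    \<open>relabel id d\<close> are multiples of \<open>p\<close>, so the 1 contributed by
    \<open>indet j\<close> would have to be one as well.\<close>
  then have "Poly_Mapping.lookup (relabel_exponent id d m) (id j) =
      Poly_Mapping.lookup (Poly_Mapping.single j 1 + relabel_exponent id d n) (id j)"
    by (simp only: monomial_inject id_apply)
  then have eq: "p * Poly_Mapping.lookup m j = 1 + p * Poly_Mapping.lookup n j"
    using lookup_relabel_exponent[of id d _ j] by (simp add: lookup_add d_def)
  have "p dvd 1"
    using eq by (metis dvd_add_left_iff dvd_triv_left)
  then show False
    using p by simp
qed

section \<open>Absence of glueable pairs\<close>

lemma glueable_prime_rows_eq:
  assumes "prime_vertex Q j" "prime_vertex Q k" "glueable Q j k" "i \<in> exch Q"
  shows "exchange_matrix Q j i = exchange_matrix Q k i"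
proof -
  obtain r :: rat where r: "r > 0"
    "\<And>i. i \<in> exch Q \<Longrightarrow> of_int (exchange_matrix Q j i) = r * of_int (exchange_matrix Q k i)"
    using assms(3) by (auto simp: glueable_def)
  obtain a b :: int where ab: "r = of_int a / of_int b" "b > 0"
    using that[of "fst (quotient_of r)" "snd (quotient_of r)"]
      quotient_of_div[of r] quotient_of_denom_pos'[of r] by simp
  then have "a > 0"
    using r(1) by (simp add: zero_less_divide_iff)
  have eq: "b * exchange_matrix Q j i = a * exchange_matrix Q k i" if "i \<in> exch Q" for i
  proof -
    have "of_int (b * exchange_matrix Q j i) = (of_int (a * exchange_matrix Q k i) :: rat)"
      using r(2)[OF that] ab by simp
    then show ?thesis
      by (simp only: of_int_eq_iff)
  qed
  \<comment> \<open>Both rows have greatest common divisor 1, so the scaled rows have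
    \<open>b\<close> and \<open>a\<close>, both being positive.\<close>
  have "Gcd ((*) b ` exchange_matrix Q j ` exch Q) = Gcd ((*) a ` exchange_matrix Q k ` exch Q)"
    using eq by (simp add: image_image)
  then have "a = b"
    using assms(1,2) \<open>a > 0\<close> \<open>b > 0\<close> by (simp add: Gcd_mult prime_vertex_def)
  then show ?thesis
    using eq[OF assms(4)] \<open>b > 0\<close> by simp
qed

lemma universal_not_glueable:
  assumes univ: "universal_root Q (Qu, xu, A)"
    and j: "j \<in> frozen Qu" and k: "k \<in> frozen Qu" and "j \<noteq> k"
  shows "\<not> glueable Qu j k"
proof
  assume glue: "glueable Qu j k"
  have R: "(Qu, xu, A) \<in> RCA Q"
    using univ by (simp add: universal_root_def)
  from R obtain w where Qu: "ice_quiver Qu" "A = cluster_algebra Qu"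
    and w: "set w \<subseteq> exch Qu" "mutate_along w (initial_seed Qu) = (Qu, xu)"
    by (rule RCA_E)
  \<comment> \<open>At vertices that are not exchangeable both rows vanish, so equality extends to
    every \<open>v\<close>.\<close>
  have row: "exchange_matrix Qu j v = exchange_matrix Qu k v" for v
  proof (cases "v \<in> exch Qu")
    case True
    then show ?thesis
      by (rule glueable_prime_rows_eq[OF universal_prime_vertex[OF univ j]
            universal_prime_vertex[OF univ k] glue])
  next
    case False
    then show ?thesis
      using arrows_outside_exch[OF Qu(1)] j k by (simp add: exchange_matrix_def)
  qed
  have arr: "arrows Qu j v = arrows Qu k v" "arrows Qu v j = arrows Qu v k" for v
    by (simp_all only: row exchange_matrix_arrows(1)[OF Qu(1), of j v]
        exchange_matrix_arrows(1)[OF Qu(1), of k v] exchange_matrix_arrows(2)[OF Qu(1), of v j]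
        exchange_matrix_arrows(2)[OF Qu(1), of v k])
  have "arrows Qu (transpose j k v) u = arrows Qu v u" "arrows Qu u (transpose j k v) = arrows Qu u v" for u v
    using arr[of u] by (simp_all add: transpose_def)
  then have transpose: "arrows Qu (transpose j k v) (transpose j k u) = 1 * 1 * arrows Qu v u" for v u
    by simp
  interpret relabeling "transpose j k" "\<lambda>_. 1" Qu Qu
  proof
    show "transpose j k permutes frozen Qu"
      using j k by (rule permutes_swap_id)
  qed (simp_all only: transpose zero_less_one)
  \<comment> \<open>The interpretation makes the swap a specialization of \<open>Qu\<close> to
    itself; it sends the variable at \<open>j\<close> to the different variable at
    \<open>k\<close>.\<close>
  have "relabel (transpose j k) (\<lambda>_. 1) (indet j) = indet j"
    using coefficient_specialization_relabel[OF w(1) w(2) w(2)]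
    by (intro universal_endomorphism[OF univ _ j]) (simp only: Qu(2))
  then show False
    using \<open>j \<noteq> k\<close> by (simp add: relabel_indet bij indet_inject)
qed

theorem proposition3p9:
  fixes Q :: quiver and A :: cluster_alg
  assumes "ice_quiver Q" and "num_frozen Q = 0"
    and "universal_geometric Q A"
  shows "prime_gluing_free A"
proof -
  \<comment> \<open>The root whose existence \<open>universal_geometric\<close> asserts is also the
    seed that witnesses prime gluing freeness.\<close>
  obtain Qu xu where univ: "universal_root Q (Qu, xu, A)"
    using assms(3) by (auto simp: universal_geometric_def universal_root_def)
  then have "(Qu, xu, A) \<in> RCA Q"
    by (simp add: universal_root_def)
  then have "rooted_cluster_algebra (Qu, xu, A)"
    by (auto simp: RCA_def)
  moreover have "prime_gluing_free_quiver Qu"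
    using universal_prime_vertex[OF univ] universal_not_glueable[OF univ]
    by (simp add: prime_gluing_free_quiver_def)
  ultimately show ?thesis
    unfolding prime_gluing_free_def by blast
qed

end
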